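(* Let $\delta=2+\sqrt[3]{2}$. For every $b,c>0$, problem $\mathcal{E}(b,c)$ admits a solution by an algorithm $\mathrm{Naive}(s,r)$ (for some constant speeds $s,r$) if and only if $cb\ge 3$. Moreover, for $cb\ge3$, the following choices are feasible and optimal among all algorithms $\mathrm{Naive}(s,r)$: if $3\le cb\le\delta$, then $s=\frac{b}{bc-2}$ and $r=b$; if $cb>\delta$, then $s=\frac{\delta}{\sqrt[3]{2}\,c}$ and $r=\frac{\delta}{c}$. The induced total evacuation energy for instance $d$ is $f(cb)\frac{2d}{c^2}$, where $f(x)=\frac{x^2}{(x-2)^2}+x^2$ for $3\le x\le\delta$ and $f(x)=\frac12(2+\sqrt[3]{2})^3$ for $x>\delta$.
   Context: Two robots start at the origin of the infinite real line. An exit is placed at an unknown point at distance $d>0$ from the origin (either at $d$ or at $-d$; either placement is called an instance $d$). A robot finds the exit if and only if it walks over it. Robots may change speed and direction at any time, and communicate wirelessly: messages are transmitted instantaneously at any distance. The evacuation time is the time at which the last robot reaches the exit. A robot moving at constant speed $s$ over a segment of length $x$ uses energy $xs^2$, and energies of successive intervals add up. The total evacuation energy is the sum of the two robots' energies used until both have reached the exit. Problem $\mathcal{E}(b,c)$: minimize the total evacuation energy over algorithms using speeds at most $b$ whose evacuation time is at most $cd$ for every instance $d$ (such algorithms are feasible solutions). Algorithm $\mathrm{Naive}(s,r)$: the two robots move in opposite directions with speed $s$ until the exit is found; the finder announces "exit found" and halts; the other robot turns around and moves at speed $r$ until it reaches the exit. *)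

theory Defs
  imports "HOL-Analysis.Analysis"
begin

datatype robot = R1 | R2

text \<open>A motion is the signed velocity of a robot as a function of time; robots start at the origin
  at time 0 and may change speed and direction finitely often in bounded time.\<close>

type_synonym motion = "real \<Rightarrow> real"

definition piecewise_constant :: "motion \<Rightarrow> bool" where
  "piecewise_constant v \<longleftrightarrow>
     (\<forall>T. \<exists>P. finite P \<and>
        (\<forall>a b. 0 \<le> a \<and> b \<le> T \<and> {a<..<b} \<inter> P = {} \<longrightarrow> v constant_on {a<..<b}))"

definition position :: "motion \<Rightarrow> real \<Rightarrow> real" where
  "position v t = integral {0..t} v"

text \<open>Moving at constant speed \<open>s\<close> over length \<open>x\<close> takes time \<open>x / s\<close>, so the energy \<open>x s\<^sup>2\<close> is
  the integral of \<open>s\<^sup>3\<close> over that time; see \<open>energy_leg\<close> below.\<close>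

definition energy :: "motion \<Rightarrow> real \<Rightarrow> real" where
  "energy v T = integral {0..T} (\<lambda>t. \<bar>v t\<bar> ^ 3)"

text \<open>A deterministic algorithm for two wireless robots. Until the exit is found, robot \<open>i\<close> moves as
  \<open>search A i\<close>. If robot \<open>f\<close> finds the exit at time \<open>T\<close>, both robots learn this at once and robot
  \<open>i\<close> continues with the motion \<open>respond A f T i\<close>, whose clock starts at \<open>T\<close>. The exit position
  reaches the algorithm only through \<open>f\<close> and \<open>T\<close>.\<close>

record algorithm =
  search :: "robot \<Rightarrow> motion"
  respond :: "robot \<Rightarrow> real \<Rightarrow> robot \<Rightarrow> motion"

definition discovery_time :: "algorithm \<Rightarrow> real \<Rightarrow> real" where
  "discovery_time A x = Inf {t. 0 \<le> t \<and> (\<exists>i. position (search A i) t = x)}"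

definition finder :: "algorithm \<Rightarrow> real \<Rightarrow> robot" where
  "finder A x = (if position (search A R1) (discovery_time A x) = x then R1 else R2)"

definition run :: "algorithm \<Rightarrow> real \<Rightarrow> robot \<Rightarrow> motion" where
  "run A x i t =
     (if \<exists>u\<in>{0..t}. \<exists>j. position (search A j) u = x
      then respond A (finder A x) (discovery_time A x) i (t - discovery_time A x)
      else search A i t)"

definition evacuates :: "algorithm \<Rightarrow> real \<Rightarrow> bool" where
  "evacuates A x \<longleftrightarrow> (\<forall>i. \<exists>t\<ge>0. position (run A x i) t = x)"

definition arrival_time :: "algorithm \<Rightarrow> real \<Rightarrow> robot \<Rightarrow> real" where
  "arrival_time A x i = Inf {t. 0 \<le> t \<and> position (run A x i) t = x}"

definition evacuation_time :: "algorithm \<Rightarrow> real \<Rightarrow> real" where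
  "evacuation_time A x = max (arrival_time A x R1) (arrival_time A x R2)"

definition evacuation_energy :: "algorithm \<Rightarrow> real \<Rightarrow> real" where
  "evacuation_energy A x =
     energy (run A x R1) (evacuation_time A x) + energy (run A x R2) (evacuation_time A x)"

definition speed_limited :: "real \<Rightarrow> motion \<Rightarrow> bool" where
  "speed_limited b v \<longleftrightarrow> piecewise_constant v \<and> (\<forall>t\<ge>0. \<bar>v t\<bar> \<le> b)"

definition feasible :: "real \<Rightarrow> real \<Rightarrow> algorithm \<Rightarrow> bool" where
  "feasible b c A \<longleftrightarrow>
     (\<forall>i. speed_limited b (search A i)) \<and>
     (\<forall>d>0. \<forall>x\<in>{d, - d}.
        (\<forall>i. speed_limited b (run A x i)) \<and> evacuates A x \<and> evacuation_time A x \<le> c * d)"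

fun heading :: "robot \<Rightarrow> real" where
  "heading R1 = 1"
| "heading R2 = - 1"

text \<open>When the exit is found at time \<open>T\<close>, the robots are \<open>2 s T\<close> apart, so the non-finder reaches the
  exit once it has moved back over that length.\<close>

definition naive :: "real \<Rightarrow> real \<Rightarrow> algorithm" where
  "naive s r =
     \<lparr> search = (\<lambda>i t. heading i * s),
       respond = (\<lambda>f T i u. if i = f then 0
                             else if r * u < 2 * s * T then - heading i * r
                             else 0) \<rparr>"

definition optimal_naive :: "real \<Rightarrow> real \<Rightarrow> real \<Rightarrow> real \<Rightarrow> bool" where
  "optimal_naive b c s r \<longleftrightarrow>
     s > 0 \<and> r > 0 \<and> feasible b c (naive s r) \<and>
     (\<forall>s'>0. \<forall>r'>0. feasible b c (naive s' r') \<longrightarrow>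
        (\<forall>d>0. \<forall>x\<in>{d, - d}.
           evacuation_energy (naive s r) x \<le> evacuation_energy (naive s' r') x))"

definition delta :: real where
  "delta = 2 + root 3 2"

text \<open>Only the values at \<open>x \<ge> 3\<close> are relevant.\<close>

definition energy_factor :: "real \<Rightarrow> real" where
  "energy_factor x =
     (if x \<le> delta then x\<^sup>2 / (x - 2)\<^sup>2 + x\<^sup>2 else (1 / 2) * (2 + root 3 2) ^ 3)"

lemma integrable_piecewise_constant:
  fixes f :: "real \<Rightarrow> real"
  assumes "finite P"
    and "\<And>p q. a \<le> p \<Longrightarrow> q \<le> b \<Longrightarrow> {p<..<q} \<inter> P = {} \<Longrightarrow> f constant_on {p<..<q}"
  shows "f integrable_on {a..b}"
  using assms
proof (induction P arbitrary: a b rule: finite_induct)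
  case empty
  obtain k where k: "\<And>t. t \<in> {a<..<b} \<Longrightarrow> f t = k"
    using empty(1)[of a b] unfolding constant_on_def by auto
  have "(\<lambda>_. k) integrable_on {a..b}" by (rule integrable_const_ivl)
  then show ?case
    by (rule integrable_spike_finite[where S = "{a, b}", rotated 2]) (use k in auto)
next
  case (insert z P)
  show ?case
  proof (cases "a < z \<and> z < b")
    case True
    have "f integrable_on {a..z}"
      by (rule insert.IH, rule insert.prems) (use True in auto)
    moreover have "f integrable_on {z..b}"
      by (rule insert.IH, rule insert.prems) (use True in auto)
    ultimately show ?thesis
      using True Henstock_Kurzweil_Integration.integrable_combine[of a z b f] by auto
  next
    case False
    show ?thesis
      by (rule insert.IH, rule insert.prems) (use False in auto)
  qed
qed

lemma energy_leg:
  assumes v: "piecewise_constant v" and "0 \<le> a" "a \<le> b"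
    and s: "\<And>t. t \<in> {a<..<b} \<Longrightarrow> v t = s"
  shows "energy v b = energy v a + (\<bar>s\<bar> * (b - a)) * \<bar>s\<bar>\<^sup>2"
proof -
  let ?g = "\<lambda>t. \<bar>v t\<bar> ^ 3"
  obtain P where "finite P"
    and P: "\<And>p q. 0 \<le> p \<Longrightarrow> q \<le> b \<Longrightarrow> {p<..<q} \<inter> P = {} \<Longrightarrow> v constant_on {p<..<q}"
    using v unfolding piecewise_constant_def by meson
  have "?g integrable_on {0..b}"
  proof (rule integrable_piecewise_constant[OF \<open>finite P\<close>])
    fix p q :: real
    assume "0 \<le> p" "q \<le> b" "{p<..<q} \<inter> P = {}"
    then show "?g constant_on {p<..<q}"
      using P[of p q] unfolding constant_on_def by metis
  qed
  then have "energy v b = energy v a + integral {a..b} ?g"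
    using Henstock_Kurzweil_Integration.integral_combine[of 0 a b ?g] assms by (simp add: energy_def)
  also have "integral {a..b} ?g = integral {a..b} (\<lambda>_. \<bar>s\<bar> ^ 3)"
    by (rule integral_spike[where S = "{a, b}"]) (use s in auto)
  also have "\<dots> = (\<bar>s\<bar> * (b - a)) * \<bar>s\<bar>\<^sup>2"
    using assms by (simp add: power3_eq_cube power2_eq_square)
  finally show ?thesis .
qed

end

theory Submission
  imports Defs
begin

text \<open>
  With exit at distance \<open>d\<close>, the finder halts at time \<open>d / s\<close> and the other robot arrives at time
  \<open>d / s + 2 d / r\<close>; the energy spent is \<open>2 d (s\<^sup>2 + r\<^sup>2)\<close>. So \<open>Naive(s, r)\<close> is feasible iff \<open>s \<le> b\<close>,
  \<open>r \<le> b\<close> and \<open>1 / s + 2 / r \<le> c\<close>, and \<open>s\<^sup>2 + r\<^sup>2\<close> has to be minimised under these constraints. It is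
  convex in \<open>(1 / s, 1 / r)\<close>, so its tangent plane at the claimed optimum bounds it from below; the
  tangent inequality \<open>s\<^sup>2 \<ge> 3 s\<^sub>0\<^sup>2 - 2 s\<^sub>0\<^sup>3 / s\<close> is an instance of AM-GM.
\<close>

section \<open>Motions of two constant-velocity legs followed by rest\<close>

definition legs :: "real \<Rightarrow> real \<Rightarrow> real \<Rightarrow> real \<Rightarrow> motion" where
  "legs p q T U t = (if t < T then p else if t < U then q else 0)"

lemma piecewise_constant_legs: "piecewise_constant (legs p q T U)"
  unfolding piecewise_constant_def
proof (intro allI exI[of _ "{T, U}"] conjI impI)
  fix a b S :: real
  assume "0 \<le> a \<and> b \<le> S \<and> {a<..<b} \<inter> {T, U} = {}"
  then have "T \<le> a \<or> b \<le> T" "U \<le> a \<or> b \<le> U" by auto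
  then have "legs p q T U t = (if b \<le> T then p else if b \<le> U then q else 0)"
    if "t \<in> {a<..<b}" for t
    using that by (auto simp: legs_def)
  then show "legs p q T U constant_on {a<..<b}"
    unfolding constant_on_def by blast
qed simp

lemma piecewise_constant_integrable: "piecewise_constant v \<Longrightarrow> v integrable_on {0..t}"
  unfolding piecewise_constant_def by (metis integrable_piecewise_constant)

lemma position_leg:
  assumes v: "piecewise_constant v" and ab: "0 \<le> a" "a \<le> b"
    and k: "\<And>t. t \<in> {a<..<b} \<Longrightarrow> v t = k"
  shows "position v b = position v a + k * (b - a)"
proof -
  have "position v b = position v a + integral {a..b} v"
    using Henstock_Kurzweil_Integration.integral_combine[of 0 a b v] ab
      piecewise_constant_integrable[OF v] by (simp add: position_def)
  also have "integral {a..b} v = integral {a..b} (\<lambda>_. k)"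
    by (rule integral_spike[where S = "{a, b}"]) (use k in auto)
  also have "\<dots> = k * (b - a)" using ab by simp
  finally show ?thesis .
qed

lemma position_legs:
  assumes "0 \<le> T" "T \<le> U" "0 \<le> t"
  shows "position (legs p q T U) t = p * min t T + q * (min t U - min t T)"
proof -
  let ?v = "legs p q T U"
  \<comment> \<open>The legs are peeled off from the last one; the minima make legs not yet begun at
    time \<open>t\<close> contribute length 0.\<close>
  have "position ?v t = position ?v (min t U) + 0 * (t - min t U)"
    by (rule position_leg[OF piecewise_constant_legs]) (use assms in \<open>auto simp: legs_def\<close>)
  also have "position ?v (min t U) = position ?v (min t T) + q * (min t U - min t T)"
    by (rule position_leg[OF piecewise_constant_legs]) (use assms in \<open>auto simp: legs_def\<close>)
  also have "position ?v (min t T) = position ?v 0 + p * (min t T - 0)"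
    by (rule position_leg[OF piecewise_constant_legs]) (use assms in \<open>auto simp: legs_def\<close>)
  finally show ?thesis by (simp add: position_def)
qed

text \<open>Cubing the speed of such a motion gives another motion of the same shape, so its energy
  is a position in disguise.\<close>

lemma energy_legs:
  assumes "0 \<le> T" "T \<le> U"
  shows "energy (legs p q T U) U = \<bar>p\<bar> ^ 3 * T + \<bar>q\<bar> ^ 3 * (U - T)"
proof -
  have "(\<lambda>t. \<bar>legs p q T U t\<bar> ^ 3) = legs (\<bar>p\<bar> ^ 3) (\<bar>q\<bar> ^ 3) T U"
    by (auto simp: legs_def)
  then have "energy (legs p q T U) U = position (legs (\<bar>p\<bar> ^ 3) (\<bar>q\<bar> ^ 3) T U) U"
    by (simp add: energy_def position_def)
  then show ?thesis using assms by (simp add: position_legs)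
qed

lemma position_const: "0 \<le> t \<Longrightarrow> position (\<lambda>_. k) t = k * t"
  by (simp add: position_def)

section \<open>Closed form of the runs of \<open>naive s r\<close>\<close>

lemma naive_search: "search (naive s r) i t = heading i * s"
  by (simp add: naive_def)

lemma naive_respond:
  "respond (naive s r) f T i u =
     (if i = f then 0 else if r * u < 2 * s * T then - heading i * r else 0)"
  by (simp add: naive_def)

lemma heading_cases: "heading i = 1 \<and> i = R1 \<or> heading i = -1 \<and> i = R2"
  by (cases i) auto

lemma all_robot: "(\<forall>i. P i) \<longleftrightarrow> P R1 \<and> P R2"
  by (metis robot.exhaust)

context
  fixes s r d :: real and j :: robot
  assumes s: "s > 0" and r: "r > 0" and d: "d > 0"
begin

text \<open>Writing the exit as \<open>heading j * d\<close> covers both placements of instance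
  \<open>d\<close> at once, and makes \<open>j\<close> the finder.\<close>

lemma naive_search_hits:
  assumes "t \<ge> 0"
  shows "position (search (naive s r) i) t = heading j * d \<longleftrightarrow> i = j \<and> t = d / s"
proof -
  have "s * t \<ge> 0" using s assms by simp
  moreover have "s * t = d \<longleftrightarrow> t = d / s" using s by (auto simp: field_simps)
  ultimately show ?thesis
    using heading_cases[of i] heading_cases[of j] d assms
    by (auto simp: naive_def position_const)
qed

lemma naive_discovery_time: "discovery_time (naive s r) (heading j * d) = d / s"
proof -
  have "{t. 0 \<le> t \<and> (\<exists>i. position (search (naive s r) i) t = heading j * d)} = {d / s}"
    using naive_search_hits s d by auto
  then show ?thesis by (simp add: discovery_time_def)
qed

lemma naive_finder: "finder (naive s r) (heading j * d) = j"
proof -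
  have "0 \<le> d / s" using s d by simp
  note hits = naive_search_hits[OF this]
  show ?thesis unfolding finder_def naive_discovery_time hits by (cases j) auto
qed

text \<open>Both robots fit one formula: the halted finder has a second leg of velocity 0, the other
  robot turns back at \<open>d / s\<close> and needs \<open>2 * d / r\<close> for the distance
  \<open>2 * d\<close>.\<close>

lemma naive_run:
  "run (naive s r) (heading j * d) i =
     legs (heading i * s) (if i = j then 0 else - heading i * r) (d / s) (d / s + 2 * d / r)"
proof
  fix t
  have found: "(\<exists>u\<in>{0..t}. \<exists>k. position (search (naive s r) k) u = heading j * d) \<longleftrightarrow> d / s \<le> t"
    using naive_search_hits s d by (auto intro!: bexI[of _ "d / s"])
  have underway: "r * (t - d / s) < 2 * s * (d / s) \<longleftrightarrow> t < d / s + 2 * d / r"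
    using s r by (simp add: field_simps)
  show "run (naive s r) (heading j * d) i t =
     legs (heading i * s) (if i = j then 0 else - heading i * r) (d / s) (d / s + 2 * d / r) t"
    unfolding run_def found naive_finder naive_discovery_time naive_respond underway
    by (auto simp: legs_def naive_search)
qed

text \<open>Each robot stays at the exit once there, so its times at the exit form a closed ray
  whose infimum is the arrival time.\<close>

lemma naive_hits_exit:
  assumes t: "t \<ge> 0"
  shows "position (run (naive s r) (heading j * d) i) t = heading j * d \<longleftrightarrow>
     d / s + (if i = j then 0 else 2 * d / r) \<le> t"
proof -
  have pos: "d / s > 0" "2 * d / r > 0" using s r d by auto
  have eq: "position (run (naive s r) (heading j * d) i) t =
      heading i * s * min t (d / s) + (if i = j then 0 else - heading i * r) *
        (min t (d / s + 2 * d / r) - min t (d / s))"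
    unfolding naive_run using pos t by (subst position_legs) auto
  show ?thesis
  proof (cases "i = j")
    case True
    have "s * min t (d / s) = d \<longleftrightarrow> d / s \<le> t"
      using s by (auto simp: min_def field_simps)
    then show ?thesis using eq True heading_cases[of j] by auto
  next
    case False
    have "r * (min t (d / s + 2 * d / r) - min t (d / s)) - s * min t (d / s) = d
        \<longleftrightarrow> d / s + 2 * d / r \<le> t"
    proof -
      \<comment> \<open>The non-finder is first on the wrong side of the origin, then strictly short
        of the exit on its way back, then resting at the exit.\<close>
      consider "t \<le> d / s" | "d / s \<le> t" "t < d / s + 2 * d / r" | "d / s + 2 * d / r \<le> t"
        by linarith
      then show ?thesis
      proof cases
        case 1
        then have "s * t \<ge> 0" using s t by simp
        then show ?thesis using 1 pos d by (simp add: min_def)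
      next
        case 2
        have "r * (t - d / s) < r * (2 * d / r)"
          by (intro mult_strict_left_mono) (use 2 r in auto)
        then show ?thesis using 2 r s d by (simp add: min_def)
      next
        case 3
        then show ?thesis using pos s r by (simp add: min_def)
      qed
    qed
    then show ?thesis
      using eq False heading_cases[of i] heading_cases[of j] by (auto simp: algebra_simps)
  qed
qed

lemma naive_arrival_time:
  "arrival_time (naive s r) (heading j * d) i = d / s + (if i = j then 0 else 2 * d / r)"
proof -
  have "0 \<le> d / s + (if i = j then 0 else 2 * d / r)" using s r d by auto
  then have "{t. 0 \<le> t \<and> position (run (naive s r) (heading j * d) i) t = heading j * d} =
      {d / s + (if i = j then 0 else 2 * d / r)..}"
    using naive_hits_exit[of _ i] by (auto simp del: if_split)
  then show ?thesis unfolding arrival_time_def by simp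
qed

lemma naive_evacuates: "evacuates (naive s r) (heading j * d)"
  unfolding evacuates_def
proof
  fix i
  have "0 \<le> d / s + (if i = j then 0 else 2 * d / r)" using s r d by auto
  then show "\<exists>t\<ge>0. position (run (naive s r) (heading j * d) i) t = heading j * d"
    using naive_hits_exit[of _ i] by blast
qed

lemma naive_evacuation_time:
  "evacuation_time (naive s r) (heading j * d) = d / s + 2 * d / r"
  unfolding evacuation_time_def naive_arrival_time using s r d by (cases j) auto

lemma naive_evacuation_energy:
  "evacuation_energy (naive s r) (heading j * d) = 2 * d * (s\<^sup>2 + r\<^sup>2)"
proof -
  have pos: "d / s \<ge> 0" "2 * d / r \<ge> 0" using s r d by auto
  have "s ^ 3 * (d / s) = d * s\<^sup>2" "r ^ 3 * (2 * d / r) = 2 * d * r\<^sup>2"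
    using s r by (simp_all add: power3_eq_cube power2_eq_square)
  then show ?thesis
    unfolding evacuation_energy_def naive_evacuation_time naive_run
    using pos s r by (cases j) (auto simp: energy_legs algebra_simps)
qed

lemma naive_run_speed_limited:
  "(\<forall>i. speed_limited b (run (naive s r) (heading j * d) i)) \<longleftrightarrow> s \<le> b \<and> r \<le> b"
proof
  assume *: "\<forall>i. speed_limited b (run (naive s r) (heading j * d) i)"
  obtain i where i: "i \<noteq> j" by (metis robot.distinct(1))
  let ?v = "run (naive s r) (heading j * d) i"
  \<comment> \<open>The non-finder uses both speeds: \<open>s\<close> at time 0 and, as the first
    leg excludes its end point, already \<open>r\<close> at time \<open>d / s\<close>.\<close>
  have "\<bar>?v 0\<bar> \<le> b" "\<bar>?v (d / s)\<bar> \<le> b"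
    using * s d unfolding speed_limited_def by auto
  then show "s \<le> b \<and> r \<le> b"
    unfolding naive_run legs_def using i s r d heading_cases[of i] by auto
next
  assume "s \<le> b \<and> r \<le> b"
  then have "\<bar>run (naive s r) (heading j * d) i t\<bar> \<le> b" for i t
    unfolding naive_run legs_def using s r heading_cases[of i] by auto
  then show "\<forall>i. speed_limited b (run (naive s r) (heading j * d) i)"
    by (simp add: speed_limited_def naive_run piecewise_constant_legs)
qed

end

section \<open>Feasibility as inequalities between \<open>s\<close>, \<open>r\<close>,
  \<open>b\<close> and \<open>c\<close>\<close>

lemma ball_exit: "(\<forall>x\<in>{d, - d}. P x) \<longleftrightarrow> (\<forall>j. P (heading j * d))"
  by (simp add: all_robot)

lemma naive_search_speed_limited:
  assumes "0 < s" "s \<le> b"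
  shows "speed_limited b (search (naive s r) i)"
  using assms heading_cases[of i]
  by (auto simp: speed_limited_def naive_def piecewise_constant_def constant_on_def)

lemma feasible_naive_iff:
  assumes s: "s > 0" and r: "r > 0"
  shows "feasible b c (naive s r) \<longleftrightarrow> s \<le> b \<and> r \<le> b \<and> 1 / s + 2 / r \<le> c"
proof -
  have time: "d / s + 2 * d / r \<le> c * d \<longleftrightarrow> 1 / s + 2 / r \<le> c" if "d > 0" for d
  proof -
    have "d / s + 2 * d / r = (1 / s + 2 / r) * d" by (simp add: field_simps)
    then show ?thesis using that by simp
  qed
  have "feasible b c (naive s r) \<longleftrightarrow>
      (\<forall>i. speed_limited b (search (naive s r) i)) \<and>
      (\<forall>d::real>0. \<forall>j::robot. (s \<le> b \<and> r \<le> b) \<and> 1 / s + 2 / r \<le> c)"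
    unfolding feasible_def ball_exit
    using assms by (simp add: naive_run_speed_limited naive_evacuates naive_evacuation_time time)
  also have "\<dots> \<longleftrightarrow> s \<le> b \<and> r \<le> b \<and> 1 / s + 2 / r \<le> c"
    \<comment> \<open>The condition no longer depends on \<open>d\<close>, so the instance
      \<open>d = 1\<close> suffices to extract it.\<close>
    using naive_search_speed_limited[OF s] zero_less_one by blast
  finally show ?thesis .
qed

section \<open>Constrained minimisation of the sum of squares\<close>

lemma square_tangent_bound:
  fixes s u :: real
  assumes "s > 0" "u > 0"
  shows "s\<^sup>2 \<ge> 3 * u\<^sup>2 - 2 * u ^ 3 / s"
proof -
  \<comment> \<open>Tangency at \<open>s = u\<close> gives
    \<open>s ^ 3 - 3 * u\<^sup>2 * s + 2 * u ^ 3\<close> the double root \<open>u\<close>.\<close>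
  have "0 \<le> (s - u)\<^sup>2 * (s + 2 * u) / s" using assms by simp
  also have "\<dots> = s\<^sup>2 - (3 * u\<^sup>2 - 2 * u ^ 3 / s)"
    using assms by (simp add: field_simps power2_eq_square power3_eq_cube)
  finally show ?thesis by simp
qed

text \<open>In the variables \<open>1 / s\<close> and \<open>1 / r\<close>, \<open>kkt\<close> is
  the Karush-Kuhn-Tucker condition at \<open>(u, v)\<close>: up to positive factors,
  \<open>u ^ 3\<close> is the multiplier of the time bound and \<open>2 * u ^ 3 - v ^ 3\<close> that
  of the bound \<open>r \<le> v\<close>. The two tangent bounds are combined with these
  weights.\<close>

lemma sum_squares_minimal:
  fixes s r u v c :: real
  assumes pos: "s > 0" "r > 0" "u > 0" "v > 0"
    and tight: "1 / u + 2 / v = c" and le: "1 / s + 2 / r \<le> c"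
    and kkt: "2 * u ^ 3 = v ^ 3 \<or> 2 * u ^ 3 \<ge> v ^ 3 \<and> r \<le> v"
  shows "u\<^sup>2 + v\<^sup>2 \<le> s\<^sup>2 + r\<^sup>2"
proof -
  have "(2 * u ^ 3 - v ^ 3) * (1 / r - 1 / v) \<ge> 0"
    using kkt
  proof
    assume "2 * u ^ 3 \<ge> v ^ 3 \<and> r \<le> v"
    then show ?thesis using pos by (intro mult_nonneg_nonneg) (auto simp: frac_le)
  qed simp
  moreover have "u ^ 3 * (1 / s + 2 / r) \<le> u ^ 3 * (1 / u + 2 / v)"
    using le tight pos by (intro mult_left_mono) auto
  moreover have "u ^ 3 * (1 / u) = u\<^sup>2" "v ^ 3 * (1 / v) = v\<^sup>2"
    using pos by (simp_all add: power2_eq_square power3_eq_cube)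
  ultimately show ?thesis
    using square_tangent_bound[of s u] square_tangent_bound[of r v] pos
    by (simp add: algebra_simps)
qed

text \<open>If \<open>v = b\<close>, the speed limit on a competitor's \<open>r\<close> is the bound
  \<open>r \<le> v\<close> of the second \<open>kkt\<close> alternative.\<close>

lemma optimal_naive_tight:
  assumes "0 < u" "u \<le> b" "0 < v" "v \<le> b" "1 / u + 2 / v = c"
    and "2 * u ^ 3 = v ^ 3 \<or> 2 * u ^ 3 \<ge> v ^ 3 \<and> v = b"
  shows "optimal_naive b c u v"
proof -
  have "u\<^sup>2 + v\<^sup>2 \<le> s\<^sup>2 + r\<^sup>2"
    if "s > 0" "r > 0" "r \<le> b" "1 / s + 2 / r \<le> c" for s r
    by (rule sum_squares_minimal[of s r u v c]) (use that assms in auto)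
  then show ?thesis
    unfolding optimal_naive_def ball_exit
    using assms by (simp add: feasible_naive_iff naive_evacuation_energy)
qed

theorem theorem2:
  fixes b c :: real
  assumes "b > 0" and "c > 0"
  shows "((\<exists>s>0. \<exists>r>0. feasible b c (naive s r)) \<longleftrightarrow> c * b \<ge> 3) \<and>
    (3 \<le> c * b \<and> c * b \<le> delta \<longrightarrow>
       optimal_naive b c (b / (b * c - 2)) b \<and>
       (\<forall>d>0. \<forall>x\<in>{d, - d}.
          evacuation_energy (naive (b / (b * c - 2)) b) x
            = energy_factor (c * b) * (2 * d / c\<^sup>2))) \<and>
    (c * b > delta \<longrightarrow>
       optimal_naive b c (delta / (root 3 2 * c)) (delta / c) \<and>
       (\<forall>d>0. \<forall>x\<in>{d, - d}.
          evacuation_energy (naive (delta / (root 3 2 * c)) (delta / c)) x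
            = energy_factor (c * b) * (2 * d / c\<^sup>2)))"
proof (intro conjI impI)
  show "(\<exists>s>0. \<exists>r>0. feasible b c (naive s r)) \<longleftrightarrow> c * b \<ge> 3"
  proof
    assume "\<exists>s>0. \<exists>r>0. feasible b c (naive s r)"
    then obtain s r where sr: "s > 0" "r > 0" "s \<le> b" "r \<le> b" "1 / s + 2 / r \<le> c"
      using feasible_naive_iff by blast
    have "1 / b \<le> 1 / s" "2 / b \<le> 2 / r"
      using sr by (auto intro!: divide_left_mono)
    then have "1 / b + 2 / b \<le> c" using sr by linarith
    then show "c * b \<ge> 3" using assms by (simp add: field_simps)
  next
    assume "c * b \<ge> 3"
    \<comment> \<open>Full speed throughout takes time \<open>3 * d / b\<close>, the least possible
      for this family.\<close>
    then have "feasible b c (naive b b)"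
      using assms by (subst feasible_naive_iff) (auto simp: field_simps)
    then show "\<exists>s>0. \<exists>r>0. feasible b c (naive s r)" using assms by blast
  qed
next
  assume bc: "3 \<le> c * b \<and> c * b \<le> delta"
  let ?s = "b / (b * c - 2)"
  have k: "b * c - 2 \<ge> 1" "b * c - 2 \<le> root 3 2"
    using bc by (auto simp: delta_def mult.commute)
  have s: "?s > 0" using k assms by simp
  \<comment> \<open>Here \<open>c * b \<le> delta\<close> enters: cubed, it becomes the sign
    condition \<open>2 * ?s ^ 3 \<ge> b ^ 3\<close>. The value of \<open>?s\<close> itself solves
    \<open>1 / ?s + 2 / b = c\<close>.\<close>
  have "(b * c - 2) ^ 3 \<le> root 3 2 ^ 3" using k by (intro power_mono) auto
  then have "(b * c - 2) ^ 3 \<le> 2" by simp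
  then have "b ^ 3 * (b * c - 2) ^ 3 \<le> b ^ 3 * 2" using assms by (intro mult_left_mono) auto
  then have "2 * ?s ^ 3 \<ge> b ^ 3" using k by (simp add: power_divide field_simps)
  moreover have "?s \<le> b" using k assms by (simp add: field_simps)
  moreover have "1 / ?s + 2 / b = c" using k assms by (simp add: field_simps)
  ultimately show "optimal_naive b c ?s b"
    using s assms by (intro optimal_naive_tight) auto
  have "?s\<^sup>2 + b\<^sup>2 = energy_factor (c * b) / c\<^sup>2"
    using bc k assms
    by (simp add: energy_factor_def add_divide_distrib power_divide power_mult_distrib mult.commute)
  then show "\<forall>d>0. \<forall>x\<in>{d, - d}.
      evacuation_energy (naive ?s b) x = energy_factor (c * b) * (2 * d / c\<^sup>2)"
    unfolding ball_exit using s assms by (simp add: naive_evacuation_energy)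
next
  assume bc: "c * b > delta"
  define k :: real where "k = root 3 2"
  have k3: "k ^ 3 = 2" by (simp add: k_def)
  have k: "k > 1" by (simp add: k_def)
  have delta: "delta = 2 + k" by (simp add: delta_def k_def)
  \<comment> \<open>Replacing 2 by \<open>k ^ 3\<close> in \<open>2 + k\<close> gives this
    factorisation, which later collapses the energy to \<open>delta ^ 3 / k ^ 3\<close>.\<close>
  have delta': "delta = k * (k\<^sup>2 + 1)"
    using k3 by (simp add: delta algebra_simps power2_eq_square power3_eq_cube)
  let ?s = "delta / (k * c)" and ?r = "delta / c"
  have pos: "?s > 0" "?r > 0" using k assms delta by auto
  have r: "?r \<le> b" using bc assms by (simp add: field_simps)
  have "?s \<le> ?r" using k assms delta by (simp add: field_simps)
  then have s: "?s \<le> b" using r by simp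
  \<comment> \<open>Since \<open>?r = k * ?s\<close>, the pair is stationary for the time bound
    alone.\<close>
  have cube: "2 * ?s ^ 3 = ?r ^ 3"
    using k3 by (simp add: power_divide power_mult_distrib)
  have "1 / ?s + 2 / ?r = (k + 2) * c / delta" by (simp add: add_divide_distrib distrib_right)
  also have "\<dots> = c" using delta k by (simp add: add.commute)
  finally have "1 / ?s + 2 / ?r = c" .
  then show "optimal_naive b c (delta / (root 3 2 * c)) (delta / c)"
    unfolding k_def[symmetric] using pos s r cube by (intro optimal_naive_tight) auto
  have "delta\<^sup>2 / k\<^sup>2 + delta\<^sup>2 = delta\<^sup>2 * (k\<^sup>2 + 1) / k\<^sup>2"
    using k by (simp add: field_simps)
  also have "\<dots> = delta ^ 3 / k ^ 3"
    using k by (simp add: delta' power2_eq_square power3_eq_cube)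
  also have "\<dots> = energy_factor (c * b)"
    using bc k3 by (simp add: energy_factor_def delta_def)
  finally have "?s\<^sup>2 + ?r\<^sup>2 = energy_factor (c * b) / c\<^sup>2"
    by (simp add: power_divide power_mult_distrib flip: divide_divide_eq_left add_divide_distrib)
  then show "\<forall>d>0. \<forall>x\<in>{d, - d}. evacuation_energy (naive (delta / (root 3 2 * c)) (delta / c)) x
      = energy_factor (c * b) * (2 * d / c\<^sup>2)"
    unfolding ball_exit k_def[symmetric] using pos by (simp add: naive_evacuation_energy)
qed

end
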